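(* Every finite poset $Q$ strongly embeds into a Boolean lattice. In fact, $Q$ is isomorphic to an induced subposet of $B_{|Q|}$; that is, there is an injection $f:Q\to B_{|Q|}$ such that for all $x,y\in Q$, $x\le_Q y$ if and only if $f(x)\subseteq f(y)$.
   Context: $B_n=2^{[n]}$ denotes the Boolean lattice of all subsets of $[n]$ ordered by inclusion. A strong embedding of a poset $P$ into a poset $R$ is an injection $f:P\to R$ such that $x\le y$ in $P$ if and only if $f(x)\le f(y)$ in $R$. *)

theory Defs
  imports Main
begin

text \<open>
  A poset is a carrier \<open>A\<close> with a relation \<open>r\<close> such that \<open>partial_order_on A r\<close>; this includes
  \<open>r \<subseteq> A \<times> A\<close>. The subposet induced on \<open>P \<subseteq> A\<close> is \<open>P\<close> with \<open>Restr r P\<close>. The constants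
  \<open>embed\<close> and \<open>iso\<close> of Main are not used: they map initial segments onto initial segments.
\<close>

definition boolean_lattice :: "nat \<Rightarrow> nat set set" where
  "boolean_lattice n = Pow {1..n}"

definition boolean_lattice_le :: "nat \<Rightarrow> nat set rel" where
  "boolean_lattice_le n = {(S, T) \<in> boolean_lattice n \<times> boolean_lattice n. S \<subseteq> T}"

definition strong_embedding ::
  "'a set \<Rightarrow> 'a rel \<Rightarrow> 'b set \<Rightarrow> 'b rel \<Rightarrow> ('a \<Rightarrow> 'b) \<Rightarrow> bool" where
  "strong_embedding A r B s f \<longleftrightarrow>
     f ` A \<subseteq> B \<and> inj_on f A \<and> (\<forall>x\<in>A. \<forall>y\<in>A. (x, y) \<in> r \<longleftrightarrow> (f x, f y) \<in> s)"

definition poset_isomorphic :: "'a set \<Rightarrow> 'a rel \<Rightarrow> 'b set \<Rightarrow> 'b rel \<Rightarrow> bool" where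
  "poset_isomorphic A r B s \<longleftrightarrow>
     (\<exists>f. bij_betw f A B \<and> (\<forall>x\<in>A. \<forall>y\<in>A. (x, y) \<in> r \<longleftrightarrow> (f x, f y) \<in> s))"

end

theory Submission
  imports Defs
begin

text \<open>
  The idea is the order-theoretic form of Cayley's theorem: a point \<open>x\<close> of a poset is determined
  by its principal down-set \<open>{z \<in> Q. z \<le> x}\<close>. Transitivity makes \<open>x \<le> y\<close> imply inclusion of the
  down-sets; reflexivity puts \<open>x\<close> into its own down-set and so gives the converse
  (\<open>principal_down_set_subset_iff\<close>). A map that reflects the order of a poset is injective by
  antisymmetry. Since \<open>Q\<close> is finite, its elements can be labelled by \<open>1, \<dots>, card Q\<close>; replacing
  each element by its label turns down-sets into subsets of \<open>{1..card Q}\<close> without changing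
  inclusions (\<open>finite_poset_inclusion_representation\<close>). This single map settles all three claims,
  its image being the required induced subposet.
\<close>

lemma principal_down_set_subset_iff:
  assumes "refl_on A r" and "trans r" and "x \<in> A" and "y \<in> A"
  shows "{z \<in> A. (z, x) \<in> r} \<subseteq> {z \<in> A. (z, y) \<in> r} \<longleftrightarrow> (x, y) \<in> r"
  using assms by (auto dest: refl_onD transD)

lemma inj_on_if_reflects_order:
  assumes "antisym r"
    and "\<And>x y. x \<in> A \<Longrightarrow> y \<in> A \<Longrightarrow> f x \<subseteq> f y \<Longrightarrow> (x, y) \<in> r"
  shows "inj_on f A"
proof (rule inj_onI)
  fix x y assume "x \<in> A" "y \<in> A" "f x = f y"
  then show "x = y"
    using assms(2)[of x y] assms(2)[of y x] antisymD[OF assms(1)] by simp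
qed

lemma finite_poset_inclusion_representation:
  assumes "finite A" and "partial_order_on A r"
  obtains f where "inj_on f A" and "f ` A \<subseteq> boolean_lattice (card A)"
    and "\<And>x y. x \<in> A \<Longrightarrow> y \<in> A \<Longrightarrow> (x, y) \<in> r \<longleftrightarrow> f x \<subseteq> f y"
proof -
  have r: "refl_on A r" "trans r" "antisym r"
    using assms(2) by (auto simp: partial_order_on_def preorder_on_def)
  obtain label where label: "bij_betw label A {1..card A}"
    using finite_same_card_bij[of A "{1..card A}"] assms(1) by auto
  define f where "f x = label ` {z \<in> A. (z, x) \<in> r}" for x
  have order: "(x, y) \<in> r \<longleftrightarrow> f x \<subseteq> f y" if "x \<in> A" "y \<in> A" for x y
  proof -
    have "f x \<subseteq> f y \<longleftrightarrow> {z \<in> A. (z, x) \<in> r} \<subseteq> {z \<in> A. (z, y) \<in> r}"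
      unfolding f_def
      by (auto simp: image_subset_iff inj_on_image_mem_iff[OF bij_betw_imp_inj_on[OF label]])
    then show ?thesis
      using principal_down_set_subset_iff[OF r(1,2) that] by simp
  qed
  have "f ` A \<subseteq> boolean_lattice (card A)"
    using bij_betw_imp_surj_on[OF label] by (auto simp: f_def boolean_lattice_def)
  moreover have "inj_on f A"
    by (rule inj_on_if_reflects_order[OF r(3)]) (simp add: order)
  ultimately show thesis
    using order by (intro that)
qed

theorem proposition3p2:
  fixes Q :: "'a set" and le :: "'a rel"
  assumes "finite Q" and "partial_order_on Q le"
  shows "(\<exists>n f. strong_embedding Q le (boolean_lattice n) (boolean_lattice_le n) f)
    \<and> (\<exists>P \<subseteq> boolean_lattice (card Q).
          poset_isomorphic Q le P (Restr (boolean_lattice_le (card Q)) P))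
    \<and> (\<exists>f. inj_on f Q \<and> f ` Q \<subseteq> boolean_lattice (card Q)
          \<and> (\<forall>x\<in>Q. \<forall>y\<in>Q. (x, y) \<in> le \<longleftrightarrow> f x \<subseteq> f y))"
proof -
  obtain f where inj: "inj_on f Q" and image: "f ` Q \<subseteq> boolean_lattice (card Q)"
    and order: "\<And>x y. x \<in> Q \<Longrightarrow> y \<in> Q \<Longrightarrow> (x, y) \<in> le \<longleftrightarrow> f x \<subseteq> f y"
    using finite_poset_inclusion_representation[OF assms] by blast
  have lattice_order: "(x, y) \<in> le \<longleftrightarrow> (f x, f y) \<in> boolean_lattice_le (card Q)"
    if "x \<in> Q" "y \<in> Q" for x y
    using order[OF that] image that by (auto simp: boolean_lattice_le_def)
  have "strong_embedding Q le (boolean_lattice (card Q)) (boolean_lattice_le (card Q)) f"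
    using inj image lattice_order by (simp add: strong_embedding_def)
  moreover have "poset_isomorphic Q le (f ` Q) (Restr (boolean_lattice_le (card Q)) (f ` Q))"
    unfolding poset_isomorphic_def
    using inj_on_imp_bij_betw[OF inj] lattice_order by (intro exI[of _ f]) simp
  ultimately show ?thesis
    using inj image order by blast
qed

end
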